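(* Let $\Theta\subseteq\mathbb R^p$ and let $\mathcal P=(P_\theta)_{\theta\in\Theta}$ be a model on a sample space $\mathcal X\subseteq\mathbb R^d$ with its Borel $\sigma$-field, dominated by a $\sigma$-finite measure $\mu$ that is finite on compact sets, with densities $p_\theta=dP_\theta/d\mu$. Suppose that $\mathcal P$ is DQM at every $\theta\in\Theta$ with score $s_\theta$, and that the mappings $(x,\theta)\mapsto p_\theta(x):\mathcal X\times\Theta\to\mathbb R_+$ and $(x,\theta)\mapsto s_\theta(x):\mathcal X\times\Theta\to\mathbb R^p$ are measurable. Then a consistent quantizer of $\mathcal P$ exists.
   Context: $\mathbb N=\{1,2,\dots\}$, $[k]=\{1,\dots,k\}$. DQM at $\theta$: $\theta$ is an interior point of $\Theta$ and there is a measurable $s_\theta:\mathcal X\to\mathbb R^p$ (the score) with $\int(\sqrt{p_{\theta+h}}-\sqrt{p_\theta}-\frac12h^Ts_\theta\sqrt{p_\theta})^2d\mu=o(\|h\|^2)$ as $h\to0$. Consistent quantizer. Let $\dot p_\theta(x):=s_\theta(x)p_\theta(x)\in\mathbb R^p$. A sequence of measurable mappings $T_m:\mathcal X\times\Theta\to\mathbb N$, $m\in\mathbb N$, is a consistent quantizer of $\mathcal P$ if there exists another sequence of measurable mappings $k_m:\Theta\to\mathbb N$ such that: (a) for all $m\in\mathbb N$, $\theta\in\Theta$, $x\in\mathcal X$: $T_m(x,\theta)\in[k_m(\theta)]$; (b) with $T_{m,\theta}(x):=T_m(x,\theta)$, $B_j:=B_{j,m}(\theta):=T_{m,\theta}^{-1}(\{j\})$,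 $J:=J_m(\theta):=\{l\in[k_m(\theta)]:0<\mu(B_{l,m}(\theta))<\infty\}$, $K(\theta):=K_{J,m}(\theta):=\bigcup_{j\in J}B_{j,m}(\theta)$, $$\bar p_\theta(x):=\sum_{j\in J}\frac{\int_{B_j}p_\theta(y)\mu(dy)}{\mu(B_j)}\mathbf 1_{B_j}(x),\qquad\bar{\dot p}_\theta(x):=\sum_{j\in J}\frac{\int_{B_j}\dot p_\theta(y)\mu(dy)}{\mu(B_j)}\mathbf 1_{B_j}(x),$$ $$\Delta_m(\theta):=\left\|(p_\theta-\bar p_\theta)\mathbf 1_{K(\theta)}\right\|_{L_1(\mu)}+\Big\|\|\dot p_\theta-\bar{\dot p}_\theta\|_{\ell_2}\mathbf 1_{K(\theta)}\Big\|_{L_1(\mu)}+\sqrt{P_\theta(K(\theta)^c)},$$ one has $\Delta_m(\theta_m)\to0$ as $m\to\infty$ for every sequence $(\theta_m)_{m\in\mathbb N}$ in $\Theta$ whose limit is also in $\Theta$. *)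

theory Defs
  imports "HOL-Probability.Probability"
begin

text \<open>
  The sample space is \<open>space \<mu>\<close>; densities \<open>p\<close> and scores \<open>s\<close> are curried with the parameter first.
  The index set of positive integers is rendered as \<open>{1..} :: nat set\<close>, so for sequences only the
  terms with index \<open>m \<ge> 1\<close> matter.
\<close>

text \<open>
  The remainder is a nonnegative Lebesgue integral with values in \<open>ennreal\<close>, so that a
  non-integrable integrand yields \<open>\<infinity>\<close> (the Bochner integral would yield \<open>0\<close>). Values of \<open>p\<close> outside
  \<open>\<Theta>\<close> are irrelevant because \<open>\<theta>\<close> is an interior point and the limit is taken as \<open>h \<rightarrow> 0\<close>.
\<close>

definition dqm_at ::
  "(real^'d) measure \<Rightarrow> (real^'p) set \<Rightarrow> (real^'p \<Rightarrow> real^'d \<Rightarrow> real) \<Rightarrow> real^'p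
    \<Rightarrow> (real^'d \<Rightarrow> real^'p) \<Rightarrow> bool" where
  "dqm_at \<mu> \<Theta> p \<theta> s\<theta> \<longleftrightarrow>
     \<theta> \<in> interior \<Theta> \<and>
     s\<theta> \<in> borel_measurable \<mu> \<and>
     ((\<lambda>h. (\<integral>\<^sup>+x. ennreal ((sqrt (p (\<theta> + h) x) - sqrt (p \<theta> x)
                 - 1/2 * (h \<bullet> s\<theta> x) * sqrt (p \<theta> x))\<^sup>2) \<partial>\<mu>) / ennreal ((norm h)\<^sup>2))
       \<longlongrightarrow> 0) (at 0)"

definition pdot ::
  "(real^'p \<Rightarrow> real^'d \<Rightarrow> real) \<Rightarrow> (real^'p \<Rightarrow> real^'d \<Rightarrow> real^'p) \<Rightarrow> real^'p \<Rightarrow> real^'d \<Rightarrow> real^'p" where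
  "pdot p s \<theta> x = p \<theta> x *\<^sub>R s \<theta> x"

text \<open>
  In the following, \<open>t\<close> is a quantizer \<open>T\<^sub>m(\<cdot>, \<theta>)\<close> with \<open>m\<close> and \<open>\<theta>\<close> fixed, and \<open>n\<close> is the
  number \<open>k\<^sub>m(\<theta>)\<close> of its cells.
\<close>

definition cell :: "(real^'d) measure \<Rightarrow> (real^'d \<Rightarrow> nat) \<Rightarrow> nat \<Rightarrow> (real^'d) set" where
  "cell \<mu> t j = {x \<in> space \<mu>. t x = j}"

definition good_cells :: "(real^'d) measure \<Rightarrow> (real^'d \<Rightarrow> nat) \<Rightarrow> nat \<Rightarrow> nat set" where
  "good_cells \<mu> t n = {l \<in> {1..n}. 0 < emeasure \<mu> (cell \<mu> t l) \<and> emeasure \<mu> (cell \<mu> t l) < \<infinity>}"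

definition good_region :: "(real^'d) measure \<Rightarrow> (real^'d \<Rightarrow> nat) \<Rightarrow> nat \<Rightarrow> (real^'d) set" where
  "good_region \<mu> t n = (\<Union>j\<in>good_cells \<mu> t n. cell \<mu> t j)"

definition cell_average ::
  "(real^'d) measure \<Rightarrow> (real^'d \<Rightarrow> nat) \<Rightarrow> nat \<Rightarrow> (real^'d \<Rightarrow> 'b::euclidean_space) \<Rightarrow> real^'d \<Rightarrow> 'b" where
  "cell_average \<mu> t n f x =
     (\<Sum>j\<in>good_cells \<mu> t n. indicator (cell \<mu> t j) x *\<^sub>R
        ((LINT y:cell \<mu> t j|\<mu>. f y) /\<^sub>R measure \<mu> (cell \<mu> t j)))"

definition quantization_error ::
  "(real^'d) measure \<Rightarrow> (real^'p \<Rightarrow> (real^'d) measure) \<Rightarrow> (real^'p \<Rightarrow> real^'d \<Rightarrow> real)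
    \<Rightarrow> (real^'p \<Rightarrow> real^'d \<Rightarrow> real^'p) \<Rightarrow> (real^'d \<Rightarrow> nat) \<Rightarrow> nat \<Rightarrow> real^'p \<Rightarrow> ennreal" where
  "quantization_error \<mu> P p s t n \<theta> =
     (\<integral>\<^sup>+x. ennreal \<bar>(p \<theta> x - cell_average \<mu> t n (p \<theta>) x) * indicator (good_region \<mu> t n) x\<bar> \<partial>\<mu>)
   + (\<integral>\<^sup>+x. ennreal \<bar>norm (pdot p s \<theta> x - cell_average \<mu> t n (pdot p s \<theta>) x)
                     * indicator (good_region \<mu> t n) x\<bar> \<partial>\<mu>)
   + ennreal (sqrt (measure (P \<theta>) (space \<mu> - good_region \<mu> t n)))"

definition consistent_quantizer ::
  "(real^'d) measure \<Rightarrow> (real^'p) set \<Rightarrow> (real^'p \<Rightarrow> (real^'d) measure)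
    \<Rightarrow> (real^'p \<Rightarrow> real^'d \<Rightarrow> real) \<Rightarrow> (real^'p \<Rightarrow> real^'d \<Rightarrow> real^'p)
    \<Rightarrow> (nat \<Rightarrow> (real^'d) \<times> (real^'p) \<Rightarrow> nat) \<Rightarrow> bool" where
  "consistent_quantizer \<mu> \<Theta> P p s T \<longleftrightarrow>
     (\<forall>m\<ge>1. T m \<in> measurable (\<mu> \<Otimes>\<^sub>M restrict_space borel \<Theta>) (count_space {1..})) \<and>
     (\<exists>k :: nat \<Rightarrow> real^'p \<Rightarrow> nat.
        (\<forall>m\<ge>1. k m \<in> measurable (restrict_space borel \<Theta>) (count_space {1..})) \<and>
        (\<forall>m\<ge>1. \<forall>\<theta>\<in>\<Theta>. \<forall>x\<in>space \<mu>. T m (x, \<theta>) \<in> {1..k m \<theta>}) \<and>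
        (\<forall>\<theta>s :: nat \<Rightarrow> real^'p. \<forall>\<theta>\<^sub>0\<in>\<Theta>.
           (\<forall>m\<ge>1. \<theta>s m \<in> \<Theta>) \<longrightarrow> \<theta>s \<longlonglongrightarrow> \<theta>\<^sub>0 \<longrightarrow>
           (\<lambda>m. quantization_error \<mu> P p s (\<lambda>x. T m (x, \<theta>s m)) (k m (\<theta>s m)) (\<theta>s m))
             \<longlonglongrightarrow> 0))"

end

theory Submission
  imports Defs
begin

text \<open>
  The quantizer may depend on \<open>\<theta>\<close>, so the sample space can be cut along the level sets of the very
  functions that have to be approximated. Write \<open>g(x, \<theta>) = (p\<^sub>\<theta>(x), p\<^sub>\<theta>(x) s\<^sub>\<theta>(x))\<close>. If \<open>g(\<cdot>, \<theta>)\<close>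
  oscillates by at most \<open>w(x)\<close> on the cell of \<open>x\<close>, then replacing it by its cell averages costs at most
  \<open>\<integral>w d\<mu>\<close> in \<open>L\<^sub>1\<close>, wherever the cell lies and however large the values of \<open>g\<close> are there. This
  bounds the error for each \<open>\<theta>\<close> separately, by a quantity that can be made small uniformly in \<open>\<theta>\<close>.

  Since \<open>\<mu>\<close> is \<open>\<sigma>\<close>-finite, there is an integrable \<open>w > 0\<close>, which can be taken of the form
  \<open>w(x) = 1 / (i(x) + 1)\<close> with a measurable integer index \<open>i\<close>
  (\<open>integrable_reciprocal_index\<close>). For \<open>\<epsilon> > 0\<close>, the point \<open>x\<close> is labelled by \<open>i(x)\<close> together with the
  first member of a dense sequence at distance less than \<open>\<epsilon> w(x)\<close> from \<open>g(x, \<theta>)\<close>. The points with a given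
  label form a set on which \<open>g(\<cdot>, \<theta>)\<close> oscillates by at most \<open>2 \<epsilon> w\<close>
  (\<open>fine_countable_partition\<close>), and which has finite measure because \<open>w\<close> is constant on it.

  There are countably many labels, while a quantizer has finitely many cells; so all labels from some
  \<open>n(\<theta>)\<close> on are merged into one residual cell, with \<open>n(\<theta>)\<close> the least integer for which
  \<open>p\<^sub>\<theta> + \<parallel>p\<^sub>\<theta> s\<^sub>\<theta>\<parallel>\<close> has integral at most \<open>\<epsilon>\<close> over that cell (\<open>measurable_truncation_index\<close>). Such
  an integer exists because both summands are integrable. For the second one this is where
  differentiability in quadratic mean enters: it makes \<open>s\<^sub>\<theta> \<surd>p\<^sub>\<theta>\<close> square integrable, and multiplying by
  \<open>\<surd>p\<^sub>\<theta>\<close> gives an integrable function (\<open>dqm_integrable_pdot\<close>).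

  The residual cell contributes \<open>O(\<epsilon>)\<close> to the \<open>L\<^sub>1\<close> errors, and up to a null set it contains the region
  not covered by cells of positive finite measure, so the last term of the error is at most \<open>\<surd>\<epsilon>\<close>
  (\<open>quantization_error_le\<close>). With \<open>\<epsilon> = 1 / (m + 1)\<close> the total tends to \<open>0\<close> uniformly in \<open>\<theta>\<close>.
\<close>

section \<open>Averaging over the cells of a fixed partition\<close>

lemma cell_sets:
  assumes "t \<in> measurable \<mu> (count_space UNIV)"
  shows "cell \<mu> t j \<in> sets \<mu>"
  using measurable_sets[OF assms, of "{j}"] by (auto simp: cell_def vimage_def Int_def conj_commute)

lemma good_region_iff:
  "x \<in> good_region \<mu> t n \<longleftrightarrow> x \<in> space \<mu> \<and> t x \<in> good_cells \<mu> t n"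
  by (auto simp: good_region_def cell_def)

lemma cell_average_eq:
  assumes "x \<in> space \<mu>" "t x \<in> good_cells \<mu> t n"
  shows "cell_average \<mu> t n f x =
    (LINT y:cell \<mu> t (t x)|\<mu>. f y) /\<^sub>R measure \<mu> (cell \<mu> t (t x))"
proof -
  have fin: "finite (good_cells \<mu> t n)"
    by (simp add: good_cells_def)
  have "cell_average \<mu> t n f x = (\<Sum>j\<in>good_cells \<mu> t n.
      if j = t x then (LINT y:cell \<mu> t j|\<mu>. f y) /\<^sub>R measure \<mu> (cell \<mu> t j) else 0)"
    unfolding cell_average_def using assms(1)
    by (intro sum.cong) (auto simp: cell_def indicator_def)
  then show ?thesis
    using assms(2) fin by (simp add: sum.delta)
qed

text \<open>
  The difference between \<open>a\<close> and the average of \<open>f\<close> over \<open>B\<close> is the average of \<open>a - f\<close> over \<open>B\<close>.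
\<close>

lemma norm_diff_average_le:
  fixes f :: "'a \<Rightarrow> 'b::euclidean_space"
  assumes B: "B \<in> sets M" "0 < emeasure M B" "emeasure M B < \<infinity>"
    and f: "integrable M f"
    and close: "\<And>y. y \<in> B \<Longrightarrow> norm (a - f y) \<le> w"
  shows "norm (a - (LINT y:B|M. f y) /\<^sub>R measure M B) \<le> w"
proof -
  have m: "measure M B > 0"
    using B by (simp add: measure_def enn2real_positive_iff)
  have fB: "set_integrable M B f"
    using f B(1) by (simp add: set_integrable_def integrable_mult_indicator)
  have cB: "set_integrable M B (\<lambda>_. c)" for c :: "'c::euclidean_space"
    using B by (simp add: set_integrable_def)
  have "(LINT y:B|M. a - f y) = measure M B *\<^sub>R a - (LINT y:B|M. f y)"
    using set_integral_diff(2)[OF cB fB, of a] B by (simp add: set_lebesgue_integral_def)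
  then have "a - (LINT y:B|M. f y) /\<^sub>R measure M B = (LINT y:B|M. a - f y) /\<^sub>R measure M B"
    using m by (simp add: scaleR_diff_right)
  moreover have "norm (LINT y:B|M. a - f y) \<le> (LINT y:B|M. w)"
  proof -
    have d: "set_integrable M B (\<lambda>y. a - f y)"
      using set_integral_diff(1)[OF cB fB] .
    have "norm (LINT y:B|M. a - f y) \<le> (LINT y:B|M. norm (a - f y))"
      by (rule set_integral_norm_bound[OF d])
    also have "\<dots> \<le> (LINT y:B|M. w)"
      by (rule set_integral_mono[OF set_integrable_norm[OF d] cB]) (use close in auto)
    finally show ?thesis .
  qed
  moreover have "(LINT y:B|M. w) = measure M B * w"
    using B by (simp add: set_lebesgue_integral_def)
  ultimately show ?thesis
    using m by (simp add: divide_simps mult.commute)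
qed

text \<open>
  The crude counterpart of \<open>norm_diff_average_le\<close>, for a cell on which nothing is known about the
  oscillation of \<open>f\<close>: only the mass of \<open>f\<close> on that cell can be used.
\<close>

lemma norm_diff_average_le_mean_norm:
  fixes f :: "'a \<Rightarrow> 'b::euclidean_space"
  assumes B: "B \<in> sets M" "0 < emeasure M B" "emeasure M B < \<infinity>"
    and f: "integrable M f"
  shows "ennreal (norm (a - (LINT y:B|M. f y) /\<^sub>R measure M B)) \<le>
    ennreal (norm a) + (\<integral>\<^sup>+y. ennreal (norm (f y)) * indicator B y \<partial>M) / emeasure M B"
proof -
  have m: "measure M B > 0" and e: "emeasure M B = ennreal (measure M B)"
    using B by (simp_all add: measure_def enn2real_positive_iff)
  have fB: "set_integrable M B f"
    using f B(1) by (simp add: set_integrable_def integrable_mult_indicator)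
  have "ennreal (norm (LINT y:B|M. f y)) \<le> (\<integral>\<^sup>+y. ennreal (norm (indicator B y *\<^sub>R f y)) \<partial>M)"
    unfolding set_lebesgue_integral_def
    using fB integral_norm_bound_ennreal unfolding set_integrable_def by blast
  also have "\<dots> = (\<integral>\<^sup>+y. ennreal (norm (f y)) * indicator B y \<partial>M)"
    by (intro nn_integral_cong) (auto simp: indicator_def)
  finally have "ennreal (norm (LINT y:B|M. f y)) / emeasure M B
      \<le> (\<integral>\<^sup>+y. ennreal (norm (f y)) * indicator B y \<partial>M) / emeasure M B"
    by (rule divide_right_mono_ennreal)
  moreover have "ennreal (norm (LINT y:B|M. f y)) / emeasure M B
      = ennreal (norm ((LINT y:B|M. f y) /\<^sub>R measure M B))"
    using m by (simp add: e divide_ennreal divide_inverse mult.commute)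
  moreover have "ennreal (norm (a - (LINT y:B|M. f y) /\<^sub>R measure M B))
      \<le> ennreal (norm a) + ennreal (norm ((LINT y:B|M. f y) /\<^sub>R measure M B))"
    by (subst ennreal_plus[symmetric]) (rule norm_ge_zero ennreal_leI norm_triangle_ineq4)+
  ultimately show ?thesis
    by (metis (no_types, lifting) add_left_mono order_trans)
qed

text \<open>
  The cell \<open>r\<close> plays the part of the residual cell. On every other cell the pointwise error is at most \<open>w\<close>;
  on cell \<open>r\<close> both \<open>f\<close> and its average have \<open>L\<^sub>1\<close> norm at most \<open>\<integral>\<parallel>f\<parallel>\<close> over the cell, whence the factor 2.
\<close>

lemma cell_average_error_le:
  fixes f :: "real^'d \<Rightarrow> 'b::euclidean_space" and w :: "real^'d \<Rightarrow> real"
  assumes t: "t \<in> measurable \<mu> (count_space UNIV)"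
    and f: "integrable \<mu> f"
    and w: "w \<in> borel_measurable \<mu>"
    and fine: "\<And>x y. x \<in> space \<mu> \<Longrightarrow> y \<in> space \<mu> \<Longrightarrow> t x = t y \<Longrightarrow> t x \<noteq> r
      \<Longrightarrow> norm (f x - f y) \<le> w x"
  shows "(\<integral>\<^sup>+x. ennreal (norm (f x - cell_average \<mu> t n f x) * indicator (good_region \<mu> t n) x) \<partial>\<mu>)
    \<le> (\<integral>\<^sup>+x. ennreal (w x) \<partial>\<mu>)
      + 2 * (\<integral>\<^sup>+x. ennreal (norm (f x)) * indicator (cell \<mu> t r) x \<partial>\<mu>)"
proof -
  let ?R = "cell \<mu> t r"
  define c where "c = (\<integral>\<^sup>+x. ennreal (norm (f x)) * indicator ?R x \<partial>\<mu>)"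
  \<comment> \<open>If the residual cell is not a good cell, it does not meet the good region and costs nothing;
    the value 0 also avoids a division by a measure that is zero or infinite.\<close>
  define d where "d = (if r \<in> good_cells \<mu> t n then c / emeasure \<mu> ?R else 0)"
  have R [measurable]: "?R \<in> sets \<mu>"
    by (rule cell_sets[OF t])
  have [measurable]: "f \<in> borel_measurable \<mu>" "w \<in> borel_measurable \<mu>"
    using f w by auto
  have "ennreal (norm (f x - cell_average \<mu> t n f x) * indicator (good_region \<mu> t n) x)
      \<le> ennreal (w x) + (ennreal (norm (f x)) * indicator ?R x + d * indicator ?R x)"
    if x: "x \<in> space \<mu>" for x
  proof (cases "t x \<in> good_cells \<mu> t n")
    case False
    then show ?thesis
      by (simp add: good_region_iff indicator_def)
  next
    case True
    let ?B = "cell \<mu> t (t x)"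
    have B: "?B \<in> sets \<mu>" "0 < emeasure \<mu> ?B" "emeasure \<mu> ?B < \<infinity>"
      using True cell_sets[OF t] by (auto simp: good_cells_def)
    have x1: "indicator (good_region \<mu> t n) x = (1::real)"
      using x True by (simp add: good_region_iff)
    show ?thesis
    proof (cases "t x = r")
      case False
      have "norm (f x - (LINT y:?B|\<mu>. f y) /\<^sub>R measure \<mu> ?B) \<le> w x"
        by (rule norm_diff_average_le[OF B f]) (use fine[OF x] False in \<open>auto simp: cell_def\<close>)
      then show ?thesis
        using False by (simp add: x1 cell_average_eq[OF x True] cell_def ennreal_leI)
    next
      case eq: True
      have "ennreal (norm (f x - (LINT y:?B|\<mu>. f y) /\<^sub>R measure \<mu> ?B)) \<le> ennreal (norm (f x)) + d"
        using norm_diff_average_le_mean_norm[OF B f, of "f x"] True by (simp add: d_def c_def eq)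
      moreover have "x \<in> ?R"
        using x eq by (simp add: cell_def)
      ultimately show ?thesis
        using add_increasing[OF zero_le]
        by (simp add: x1 cell_average_eq[OF x True])
    qed
  qed
  then have "(\<integral>\<^sup>+x. ennreal (norm (f x - cell_average \<mu> t n f x) * indicator (good_region \<mu> t n) x) \<partial>\<mu>)
      \<le> (\<integral>\<^sup>+x. ennreal (w x) + (ennreal (norm (f x)) * indicator ?R x + d * indicator ?R x) \<partial>\<mu>)"
    by (rule nn_integral_mono)
  also have "\<dots> = (\<integral>\<^sup>+x. ennreal (w x) \<partial>\<mu>) + (c + d * emeasure \<mu> ?R)"
    unfolding c_def by (simp add: nn_integral_add nn_integral_cmult_indicator)
  also have "d * emeasure \<mu> ?R \<le> c"
    by (auto simp: d_def good_cells_def ennreal_divide_times ennreal_times_divide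
        divide_eq_1_ennreal mult.commute mult_divide_eq_ennreal)
  finally show ?thesis
    by (simp add: c_def mult_2)
qed

text \<open>
  A cell outside the good region is either null, and then carries no probability, or of infinite
  measure, and then it can only be the last one.
\<close>

lemma prob_bad_region_le:
  fixes q :: "real^'d \<Rightarrow> real"
  assumes t: "t \<in> measurable \<mu> (count_space UNIV)"
    and range: "\<And>x. x \<in> space \<mu> \<Longrightarrow> t x \<in> {1..n}"
    and q: "q \<in> borel_measurable \<mu>"
    and fin: "\<And>j. j \<noteq> n \<Longrightarrow> emeasure \<mu> (cell \<mu> t j) < \<infinity>"
  shows "emeasure (density \<mu> (\<lambda>x. ennreal (q x))) (space \<mu> - good_region \<mu> t n)
    \<le> (\<integral>\<^sup>+x. ennreal (q x) * indicator (cell \<mu> t n) x \<partial>\<mu>)"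
proof -
  have cs: "cell \<mu> t j \<in> sets \<mu>" for j
    by (rule cell_sets[OF t])
  have fg: "finite (good_cells \<mu> t n)"
    by (simp add: good_cells_def)
  have gr: "space \<mu> - good_region \<mu> t n \<in> sets \<mu>"
    unfolding good_region_def using cs fg by auto
  define Z where "Z = (\<Union>j\<in>{j\<in>{1..n}. emeasure \<mu> (cell \<mu> t j) = 0}. cell \<mu> t j)"
  have "Z \<in> null_sets \<mu>"
    unfolding Z_def by (intro null_sets.finite_UN) (use cs in auto)
  then have "AE x in \<mu>. x \<notin> Z"
    by (rule AE_not_in)
  then have "AE x in \<mu>. ennreal (q x) * indicator (space \<mu> - good_region \<mu> t n) x
      \<le> ennreal (q x) * indicator (cell \<mu> t n) x"
  proof eventually_elim
    case (elim x)
    have "x \<in> cell \<mu> t n" if x: "x \<in> space \<mu>" "x \<notin> good_region \<mu> t n"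
    proof (rule ccontr)
      assume "x \<notin> cell \<mu> t n"
      then have "emeasure \<mu> (cell \<mu> t (t x)) < \<infinity>"
        using fin x by (auto simp: cell_def)
      moreover have "emeasure \<mu> (cell \<mu> t (t x)) \<noteq> 0"
        using elim x range[OF x(1)] by (auto simp: Z_def cell_def)
      ultimately have "t x \<in> good_cells \<mu> t n"
        using range[OF x(1)] by (auto simp: good_cells_def zero_less_iff_neq_zero)
      with x show False
        by (simp add: good_region_iff)
    qed
    then show ?case
      by (auto simp: indicator_def)
  qed
  then show ?thesis
    using q gr by (simp add: emeasure_density nn_integral_mono_AE)
qed

text \<open>
  Each of the two \<open>L\<^sub>1\<close> errors costs \<open>\<integral>w\<close> for the oscillation and \<open>2 \<delta>\<close> for the residual cell \<open>n\<close>. The joint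
  oscillation and the joint tail mass of density and derivative are bounded because one partition has
  to serve both.
\<close>

lemma quantization_error_le:
  fixes p :: "real^'p \<Rightarrow> real^'d \<Rightarrow> real" and s :: "real^'p \<Rightarrow> real^'d \<Rightarrow> real^'p"
    and w :: "real^'d \<Rightarrow> real" and \<delta> :: real
  assumes t: "t \<in> measurable \<mu> (count_space UNIV)"
    and range: "\<And>x. x \<in> space \<mu> \<Longrightarrow> t x \<in> {1..n}"
    and P: "P \<theta> = density \<mu> (\<lambda>x. ennreal (p \<theta> x))"
    and p: "integrable \<mu> (p \<theta>)"
    and pd: "integrable \<mu> (pdot p s \<theta>)"
    and w: "w \<in> borel_measurable \<mu>"
    and fin: "\<And>j. j \<noteq> n \<Longrightarrow> emeasure \<mu> (cell \<mu> t j) < \<infinity>"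
    and fine: "\<And>x y. x \<in> space \<mu> \<Longrightarrow> y \<in> space \<mu> \<Longrightarrow> t x = t y \<Longrightarrow> t x \<noteq> n
      \<Longrightarrow> dist (p \<theta> x, pdot p s \<theta> x) (p \<theta> y, pdot p s \<theta> y) \<le> w x"
    and tail: "(\<integral>\<^sup>+x. ennreal (\<bar>p \<theta> x\<bar> + norm (pdot p s \<theta> x)) * indicator (cell \<mu> t n) x \<partial>\<mu>) \<le> ennreal \<delta>"
    and \<delta>: "0 \<le> \<delta>"
  shows "quantization_error \<mu> P p s t n \<theta>
    \<le> 2 * (\<integral>\<^sup>+x. ennreal (w x) \<partial>\<mu>) + ennreal (4 * \<delta> + sqrt \<delta>)"
proof -
  let ?W = "\<integral>\<^sup>+x. ennreal (w x) \<partial>\<mu>"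
  have tail1: "(\<integral>\<^sup>+x. ennreal (norm (p \<theta> x)) * indicator (cell \<mu> t n) x \<partial>\<mu>) \<le> ennreal \<delta>"
    by (rule order_trans[OF nn_integral_mono tail]) (auto intro!: mult_right_mono ennreal_leI)
  have tail2: "(\<integral>\<^sup>+x. ennreal (norm (pdot p s \<theta> x)) * indicator (cell \<mu> t n) x \<partial>\<mu>) \<le> ennreal \<delta>"
    by (rule order_trans[OF nn_integral_mono tail]) (auto intro!: mult_right_mono ennreal_leI)
  have 1: "(\<integral>\<^sup>+x. ennreal \<bar>(p \<theta> x - cell_average \<mu> t n (p \<theta>) x) * indicator (good_region \<mu> t n) x\<bar> \<partial>\<mu>)
      \<le> ?W + 2 * ennreal \<delta>"
  proof -
    have "norm (p \<theta> x - p \<theta> y) \<le> w x"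
      if "x \<in> space \<mu>" "y \<in> space \<mu>" "t x = t y" "t x \<noteq> n" for x y
      using fine[OF that] dist_fst_le[of "(p \<theta> x, pdot p s \<theta> x)" "(p \<theta> y, pdot p s \<theta> y)"]
      by (simp add: dist_norm)
    note error = cell_average_error_le[OF t p w this, of n]
    have "(\<integral>\<^sup>+x. ennreal \<bar>(p \<theta> x - cell_average \<mu> t n (p \<theta>) x) * indicator (good_region \<mu> t n) x\<bar> \<partial>\<mu>)
        = (\<integral>\<^sup>+x. ennreal (norm (p \<theta> x - cell_average \<mu> t n (p \<theta>) x) * indicator (good_region \<mu> t n) x) \<partial>\<mu>)"
      by (simp add: abs_mult)
    also note error
    also have "?W + 2 * (\<integral>\<^sup>+x. ennreal (norm (p \<theta> x)) * indicator (cell \<mu> t n) x \<partial>\<mu>)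
        \<le> ?W + 2 * ennreal \<delta>"
      by (intro add_mono order_refl mult_left_mono tail1) simp
    finally show ?thesis .
  qed
  have 2: "(\<integral>\<^sup>+x. ennreal \<bar>norm (pdot p s \<theta> x - cell_average \<mu> t n (pdot p s \<theta>) x)
        * indicator (good_region \<mu> t n) x\<bar> \<partial>\<mu>) \<le> ?W + 2 * ennreal \<delta>"
  proof -
    have "norm (pdot p s \<theta> x - pdot p s \<theta> y) \<le> w x"
      if "x \<in> space \<mu>" "y \<in> space \<mu>" "t x = t y" "t x \<noteq> n" for x y
      using fine[OF that] dist_snd_le[of "(p \<theta> x, pdot p s \<theta> x)" "(p \<theta> y, pdot p s \<theta> y)"]
      by (simp add: dist_norm)
    note error = cell_average_error_le[OF t pd w this, of n]
    have "(\<integral>\<^sup>+x. ennreal \<bar>norm (pdot p s \<theta> x - cell_average \<mu> t n (pdot p s \<theta>) x)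
          * indicator (good_region \<mu> t n) x\<bar> \<partial>\<mu>)
        = (\<integral>\<^sup>+x. ennreal (norm (pdot p s \<theta> x - cell_average \<mu> t n (pdot p s \<theta>) x)
          * indicator (good_region \<mu> t n) x) \<partial>\<mu>)"
      by (simp add: abs_mult)
    also note error
    also have "?W + 2 * (\<integral>\<^sup>+x. ennreal (norm (pdot p s \<theta> x)) * indicator (cell \<mu> t n) x \<partial>\<mu>)
        \<le> ?W + 2 * ennreal \<delta>"
      by (intro add_mono order_refl mult_left_mono tail2) simp
    finally show ?thesis .
  qed
  have "emeasure (P \<theta>) (space \<mu> - good_region \<mu> t n)
      \<le> (\<integral>\<^sup>+x. ennreal (p \<theta> x) * indicator (cell \<mu> t n) x \<partial>\<mu>)"
    unfolding P by (rule prob_bad_region_le[OF t range _ fin]) (use p in auto)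
  also have "\<dots> \<le> (\<integral>\<^sup>+x. ennreal (norm (p \<theta> x)) * indicator (cell \<mu> t n) x \<partial>\<mu>)"
    by (intro nn_integral_mono mult_right_mono ennreal_leI) auto
  also note tail1
  finally have "measure (P \<theta>) (space \<mu> - good_region \<mu> t n) \<le> \<delta>"
    using \<delta> by (simp add: measure_def enn2real_leI)
  then have 3: "ennreal (sqrt (measure (P \<theta>) (space \<mu> - good_region \<mu> t n))) \<le> ennreal (sqrt \<delta>)"
    by (intro ennreal_leI) simp
  have "quantization_error \<mu> P p s t n \<theta>
      \<le> (?W + 2 * ennreal \<delta>) + (?W + 2 * ennreal \<delta>) + ennreal (sqrt \<delta>)"
    unfolding quantization_error_def by (intro add_mono 1 2 3)
  also have "\<dots> = 2 * ?W + (4 * ennreal \<delta> + ennreal (sqrt \<delta>))"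
  proof -
    have "4 * ennreal \<delta> = 2 * ennreal \<delta> + 2 * ennreal \<delta>"
      by (simp flip: distrib_right)
    then show ?thesis
      by (simp only: mult_2[of ?W] ac_simps)
  qed
  also have "4 * ennreal \<delta> + ennreal (sqrt \<delta>) = ennreal (4 * \<delta> + sqrt \<delta>)"
    using \<delta> by (simp add: ennreal_mult)
  finally show ?thesis .
qed

section \<open>Partitions that depend measurably on the parameter\<close>

text \<open>
  A \<open>\<sigma>\<close>-finite measure admits an integrable function \<open>h > 0\<close>; rounding \<open>h\<close> down to the next reciprocal
  of a positive integer keeps it positive and integrable and makes its range countable, so that the
  cells of a countable partition can be chosen inside its level sets.
\<close>

lemma (in sigma_finite_measure) integrable_reciprocal_index:
  "\<exists>i :: 'a \<Rightarrow> nat. i \<in> measurable M (count_space UNIV) \<and>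
     (\<integral>\<^sup>+x. ennreal (1 / real (Suc (i x))) \<partial>M) < \<infinity>"
proof -
  obtain h where h [measurable]: "h \<in> borel_measurable M" and fin: "integral\<^sup>N M h \<noteq> \<infinity>"
    and pos: "\<And>x. x \<in> space M \<Longrightarrow> 0 < h x \<and> h x < \<infinity>"
    using Ex_finite_integrable_function by blast
  define i where "i x = (LEAST j. ennreal (1 / real (Suc j)) \<le> h x)" for x
  have i [measurable]: "i \<in> measurable M (count_space UNIV)"
    unfolding i_def by measurable
  have "ennreal (1 / real (Suc (i x))) \<le> h x" if x: "x \<in> space M" for x
  proof -
    obtain r where r: "h x = ennreal r" "0 < r"
      using pos[OF x] by (cases "h x") auto
    obtain j where "inverse (real (Suc j)) < r"
      using reals_Archimedean r(2) by blast
    then have "ennreal (1 / real (Suc j)) \<le> h x"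
      using r by (simp add: ennreal_leI inverse_eq_divide)
    then show ?thesis
      unfolding i_def by (rule LeastI)
  qed
  then have "(\<integral>\<^sup>+x. ennreal (1 / real (Suc (i x))) \<partial>M) \<le> integral\<^sup>N M h"
    by (rule nn_integral_mono)
  also have "\<dots> < \<infinity>"
    using fin by (simp add: top.not_eq_extremum)
  finally show ?thesis
    using i by blast
qed

lemma finite_measure_level_set:
  assumes i [measurable]: "i \<in> measurable M (count_space UNIV)"
    and fin: "(\<integral>\<^sup>+x. ennreal (1 / real (Suc (i x))) \<partial>M) < \<infinity>"
  shows "emeasure M {x \<in> space M. i x = l} < \<infinity>"
proof -
  have "ennreal (1 / real (Suc l)) * emeasure M {x \<in> space M. i x = l}
      = (\<integral>\<^sup>+x. ennreal (1 / real (Suc l)) * indicator {x \<in> space M. i x = l} x \<partial>M)"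
    by (simp add: nn_integral_cmult_indicator)
  also have "\<dots> \<le> (\<integral>\<^sup>+x. ennreal (1 / real (Suc (i x))) \<partial>M)"
    by (intro nn_integral_mono) (auto simp: indicator_def)
  finally have "ennreal (1 / real (Suc l)) * emeasure M {x \<in> space M. i x = l} < \<infinity>"
    using fin by (rule le_less_trans)
  then show ?thesis
    by (auto simp: ennreal_mult_less_top)
qed

text \<open>
  The label \<open>c (x, t)\<close> encodes \<open>i x\<close> and the first point of a dense sequence within \<open>w (i x)\<close> of
  \<open>g (x, t)\<close>; choosing the first such point makes \<open>c\<close> jointly measurable. Equal labels mean equal
  tolerances and a common nearby point, hence the factor 2. The decoding \<open>\<iota>\<close> records that each label
  determines \<open>i\<close>, which bounds the measure of the corresponding cell.
\<close>

lemma fine_countable_partition: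
  fixes g :: "'a \<times> 't \<Rightarrow> 'e::{metric_space, second_countable_topology}"
    and w :: "nat \<Rightarrow> real" and i :: "'a \<Rightarrow> nat"
  assumes g [measurable]: "g \<in> borel_measurable (M \<Otimes>\<^sub>M N)"
    and i [measurable]: "i \<in> measurable M (count_space UNIV)"
    and pos: "\<And>l. 0 < w l"
  shows "\<exists>c \<in> measurable (M \<Otimes>\<^sub>M N) (count_space UNIV). \<exists>\<iota> :: nat \<Rightarrow> nat.
    (\<forall>x t. \<iota> (c (x, t)) = i x) \<and>
    (\<forall>x y t. c (x, t) = c (y, t) \<longrightarrow> dist (g (x, t)) (g (y, t)) \<le> 2 * w (i x))"
proof -
  obtain D :: "'e set" where D: "countable D" "\<And>U. open U \<Longrightarrow> U \<noteq> {} \<Longrightarrow> \<exists>d\<in>D. d \<in> U"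
    by (rule countable_dense_setE) blast
  define q where "q = from_nat_into D"
  define j where "j z = (LEAST n. dist (g z) (q n) < w (i (fst z)))" for z
  define c where "c z = prod_encode (i (fst z), j z)" for z
  have [measurable]: "(\<lambda>z. w (i (fst z))) \<in> borel_measurable (M \<Otimes>\<^sub>M N)"
    using measurable_compose[OF measurable_compose[OF measurable_fst i], of w borel] by simp
  have [measurable]: "j \<in> measurable (M \<Otimes>\<^sub>M N) (count_space UNIV)"
    unfolding j_def by measurable
  have c: "c \<in> measurable (M \<Otimes>\<^sub>M N) (count_space UNIV)"
    unfolding c_def by measurable
  have near: "dist (g z) (q (j z)) < w (i (fst z))" for z
  proof -
    have "\<exists>d\<in>D. d \<in> ball (g z) (w (i (fst z)))"
      using D(2)[of "ball (g z) (w (i (fst z)))"] pos[of "i (fst z)"] by (simp add: not_le)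
    then obtain n where "dist (g z) (q n) < w (i (fst z))"
      unfolding q_def by (metis D(1) from_nat_into_surj mem_ball)
    then show ?thesis
      unfolding j_def by (rule LeastI)
  qed
  have "dist (g (x, t)) (g (y, t)) \<le> 2 * w (i x)" if "c (x, t) = c (y, t)" for x y t
  proof -
    have "i x = i y" "j (x, t) = j (y, t)"
      using that by (auto simp: c_def)
    then show ?thesis
      using near[of "(x, t)"] near[of "(y, t)"]
        dist_triangle2[of "g (x, t)" "g (y, t)" "q (j (x, t))"] by simp
  qed
  moreover have "(fst \<circ> prod_decode) (c (x, t)) = i x" for x t
    by (simp add: c_def)
  ultimately show ?thesis
    using c by blast
qed

text \<open>
  For each \<open>t\<close> the tails \<open>{x. k \<le> c (x, t)}\<close> decrease to the empty set, so by dominated convergence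
  their \<open>F\<close>-mass tends to \<open>0\<close>. By Tonelli this mass is measurable in \<open>t\<close>, and hence so is the first \<open>k\<close> for
  which it is at most \<open>\<delta>\<close>.
\<close>

lemma (in sigma_finite_measure) measurable_truncation_index:
  fixes F :: "'a \<times> 't \<Rightarrow> ennreal" and c :: "'a \<times> 't \<Rightarrow> nat"
  assumes F [measurable]: "F \<in> borel_measurable (M \<Otimes>\<^sub>M N)"
    and c [measurable]: "c \<in> measurable (M \<Otimes>\<^sub>M N) (count_space UNIV)"
    and fin: "\<And>t. t \<in> space N \<Longrightarrow> (\<integral>\<^sup>+x. F (x, t) \<partial>M) < \<infinity>"
    and \<delta>: "0 < \<delta>"
  shows "\<exists>n \<in> measurable N (count_space UNIV). \<forall>t \<in> space N.
    (\<integral>\<^sup>+x. F (x, t) * indicator {x. n t \<le> c (x, t)} x \<partial>M) \<le> \<delta>"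
proof -
  define R where "R k t = (\<integral>\<^sup>+x. (if k \<le> c (x, t) then F (x, t) else 0) \<partial>M)" for k :: nat and t
  define n where "n t = (LEAST k. R k t \<le> \<delta>)" for t
  have [measurable]: "R k \<in> borel_measurable N" for k
    unfolding R_def by measurable
  have "n \<in> measurable N (count_space UNIV)"
    unfolding n_def by measurable
  moreover have "R (n t) t \<le> \<delta>" if t: "t \<in> space N" for t
  proof -
    have [measurable]: "(\<lambda>x. F (x, t)) \<in> borel_measurable M"
        "(\<lambda>x. c (x, t)) \<in> measurable M (count_space UNIV)"
      using t by measurable
    have "(\<lambda>k. R k t) \<longlonglongrightarrow> (\<integral>\<^sup>+x. 0 \<partial>M)"
      unfolding R_def
    proof (rule nn_integral_dominated_convergence[where w = "\<lambda>x. F (x, t)"])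
      show "AE x in M. (\<lambda>k. if k \<le> c (x, t) then F (x, t) else 0) \<longlonglongrightarrow> 0"
      proof (rule AE_I2)
        fix x
        have "\<forall>\<^sub>F k in sequentially. (if k \<le> c (x, t) then F (x, t) else 0) = 0"
          using eventually_gt_at_top[of "c (x, t)"] by eventually_elim auto
        then show "(\<lambda>k. if k \<le> c (x, t) then F (x, t) else 0) \<longlonglongrightarrow> 0"
          by (rule tendsto_eventually)
      qed
    qed (use fin[OF t] in auto)
    then have "\<forall>\<^sub>F k in sequentially. R k t < \<delta>"
      using \<delta> by (simp add: order_tendsto_iff)
    then obtain k where "R k t \<le> \<delta>"
      by (meson eventually_sequentially less_imp_le order_refl)
    then show ?thesis
      unfolding n_def by (rule LeastI)
  qed
  moreover have "(\<integral>\<^sup>+x. F (x, t) * indicator {x. n t \<le> c (x, t)} x \<partial>M) = R (n t) t" for t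
    unfolding R_def by (intro nn_integral_cong) (auto simp: indicator_def)
  ultimately show ?thesis
    by (intro bexI[of _ n]) simp_all
qed

section \<open>Integrability of the derivative of the density\<close>

text \<open>
  Choose a multiple \<open>h\<close> of \<open>b\<close> so small that \<open>\<theta> + h\<close> lies in \<open>\<Theta>\<close> and the remainder in the definition of
  differentiability in quadratic mean is square integrable. Then \<open>(h \<bullet> s\<^sub>\<theta>) \<surd>p\<^sub>\<theta>\<close> is a linear
  combination of the remainder and of two root densities, all in \<open>L\<^sub>2\<close>; its product with \<open>\<surd>p\<^sub>\<theta>\<close> is
  therefore in \<open>L\<^sub>1\<close>.
\<close>

lemma dqm_integrable_directional:
  fixes p :: "real^'p \<Rightarrow> real^'d \<Rightarrow> real"
  assumes p: "\<And>\<theta>. \<theta> \<in> \<Theta> \<Longrightarrow> integrable \<mu> (p \<theta>)"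
    and nonneg: "\<And>\<theta> x. \<theta> \<in> \<Theta> \<Longrightarrow> x \<in> space \<mu> \<Longrightarrow> 0 \<le> p \<theta> x"
    and dqm: "dqm_at \<mu> \<Theta> p \<theta> s\<theta>"
    and b: "norm b = 1"
  shows "integrable \<mu> (\<lambda>x. p \<theta> x * (b \<bullet> s\<theta> x))"
proof -
  let ?R = "\<lambda>h x. sqrt (p (\<theta> + h) x) - sqrt (p \<theta> x) - 1/2 * (h \<bullet> s\<theta> x) * sqrt (p \<theta> x)"
  have int: "\<theta> \<in> interior \<Theta>" and s [measurable]: "s\<theta> \<in> borel_measurable \<mu>"
    and lim: "((\<lambda>h. (\<integral>\<^sup>+x. ennreal ((?R h x)\<^sup>2) \<partial>\<mu>) / ennreal ((norm h)\<^sup>2)) \<longlongrightarrow> 0) (at 0)"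
    using dqm by (auto simp: dqm_at_def)
  have \<theta>: "\<theta> \<in> \<Theta>"
    using int interior_subset by blast
  have "\<forall>\<^sub>F h in at 0. (\<integral>\<^sup>+x. ennreal ((?R h x)\<^sup>2) \<partial>\<mu>) / ennreal ((norm h)\<^sup>2) < 1"
    using lim by (simp add: order_tendsto_iff)
  then obtain d1 where d1: "0 < d1" "\<And>h. h \<noteq> 0 \<Longrightarrow> norm h < d1 \<Longrightarrow>
      (\<integral>\<^sup>+x. ennreal ((?R h x)\<^sup>2) \<partial>\<mu>) / ennreal ((norm h)\<^sup>2) < 1"
    by (auto simp: eventually_at)
  obtain d2 where d2: "0 < d2" "ball \<theta> d2 \<subseteq> \<Theta>"
    using int by (auto simp: mem_interior)
  define u where "u = min d1 d2 / 2"
  define h where "h = u *\<^sub>R b"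
  have u: "0 < u" "u < d1" "u < d2"
    using d1(1) d2(1) by (auto simp: u_def)
  have nh: "norm h = u"
    using u b by (simp add: h_def)
  have h\<Theta>: "\<theta> + h \<in> \<Theta>"
    using d2(2) nh u by (auto simp: dist_norm)
  have [measurable]: "p \<theta> \<in> borel_measurable \<mu>" "p (\<theta> + h) \<in> borel_measurable \<mu>"
    using p[OF \<theta>] p[OF h\<Theta>] by auto
  have "(\<integral>\<^sup>+x. ennreal ((?R h x)\<^sup>2) \<partial>\<mu>) / ennreal ((norm h)\<^sup>2) < 1"
    using d1(2)[of h] u nh by auto
  then have "(\<integral>\<^sup>+x. ennreal ((?R h x)\<^sup>2) \<partial>\<mu>) < \<infinity>"
    by (cases "(\<integral>\<^sup>+x. ennreal ((?R h x)\<^sup>2) \<partial>\<mu>) = \<infinity>")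
      (auto simp: ennreal_top_divide less_top[symmetric])
  then have R: "integrable \<mu> (\<lambda>x. (?R h x)\<^sup>2)"
    by (intro integrableI_bounded) simp_all
  \<comment> \<open>The constants: \<open>Y = 2 (B - A - r)\<close> gives \<open>Y\<^sup>2 \<le> 4 * 3 (A\<^sup>2 + B\<^sup>2 + r\<^sup>2)\<close>, and
    \<open>\<bar>A Y\<bar> \<le> A\<^sup>2 + Y\<^sup>2\<close> adds one more \<open>A\<^sup>2\<close>, where \<open>A\<close> and \<open>B\<close> are the root densities at \<open>\<theta>\<close> and
    \<open>\<theta> + h\<close>, \<open>r\<close> is the remainder and \<open>Y = (h \<bullet> s\<^sub>\<theta>) A\<close>.\<close>
  have bound: "integrable \<mu> (\<lambda>x. (13 * p \<theta> x + 12 * p (\<theta> + h) x + 12 * (?R h x)\<^sup>2) / u)"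
    by (intro integrable_divide Bochner_Integration.integrable_add integrable_mult_right p \<theta> h\<Theta> R)
  show ?thesis
  proof (rule Bochner_Integration.integrable_bound[OF bound])
    show "AE x in \<mu>. norm (p \<theta> x * (b \<bullet> s\<theta> x))
        \<le> norm ((13 * p \<theta> x + 12 * p (\<theta> + h) x + 12 * (?R h x)\<^sup>2) / u)"
    proof (rule AE_I2)
      fix x assume x: "x \<in> space \<mu>"
      define A where "A = sqrt (p \<theta> x)"
      define B where "B = sqrt (p (\<theta> + h) x)"
      define Y where "Y = (h \<bullet> s\<theta> x) * A"
      have A: "A\<^sup>2 = p \<theta> x" "0 \<le> A" and B: "B\<^sup>2 = p (\<theta> + h) x"
        using nonneg[OF \<theta> x] nonneg[OF h\<Theta> x] by (simp_all add: A_def B_def)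
      have R_eq: "?R h x = B - A - Y / 2"
        by (simp add: A_def B_def Y_def)
      have "\<bar>A * Y\<bar> \<le> A\<^sup>2 + Y\<^sup>2"
        using sum_squares_ge_zero[of A Y] zero_le_power2[of "A - Y"] zero_le_power2[of "A + Y"]
        by (simp add: power2_eq_square algebra_simps abs_le_iff)
      also have "Y\<^sup>2 \<le> 12 * A\<^sup>2 + 12 * B\<^sup>2 + 12 * (B - A - Y / 2)\<^sup>2"
      proof -
        define r where "r = B - A - Y / 2"
        have Y: "Y = 2 * (B - A - r)"
          by (simp add: r_def)
        have "12 * A\<^sup>2 + 12 * B\<^sup>2 + 12 * r\<^sup>2 - Y\<^sup>2
            = 4 * (A + B)\<^sup>2 + 4 * (A - r)\<^sup>2 + 4 * (B + r)\<^sup>2"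
          unfolding Y by (simp add: power2_eq_square algebra_simps)
        then show ?thesis
          unfolding r_def[symmetric] by (smt (verit) zero_le_power2)
      qed
      finally have "\<bar>A * Y\<bar> \<le> 13 * p \<theta> x + 12 * p (\<theta> + h) x + 12 * (?R h x)\<^sup>2"
        unfolding R_eq A B by simp
      moreover have "A * Y = u * (p \<theta> x * (b \<bullet> s\<theta> x))"
        using A(1) by (simp add: Y_def h_def power2_eq_square mult_ac)
      ultimately have "\<bar>p \<theta> x * (b \<bullet> s\<theta> x)\<bar>
          \<le> (13 * p \<theta> x + 12 * p (\<theta> + h) x + 12 * (?R h x)\<^sup>2) / u"
        using u(1) by (simp add: pos_le_divide_eq abs_mult mult.commute mult.left_commute)
      then show "norm (p \<theta> x * (b \<bullet> s\<theta> x))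
          \<le> norm ((13 * p \<theta> x + 12 * p (\<theta> + h) x + 12 * (?R h x)\<^sup>2) / u)"
        unfolding real_norm_def by (rule order_trans[OF _ abs_ge_self])
    qed
  qed measurable
qed

lemma dqm_integrable_pdot:
  fixes p :: "real^'p \<Rightarrow> real^'d \<Rightarrow> real"
  assumes p: "\<And>\<theta>. \<theta> \<in> \<Theta> \<Longrightarrow> integrable \<mu> (p \<theta>)"
    and nonneg: "\<And>\<theta> x. \<theta> \<in> \<Theta> \<Longrightarrow> x \<in> space \<mu> \<Longrightarrow> 0 \<le> p \<theta> x"
    and dqm: "dqm_at \<mu> \<Theta> p \<theta> (s \<theta>)"
  shows "integrable \<mu> (pdot p s \<theta>)"
proof -
  have "integrable \<mu> (\<lambda>x. \<Sum>b\<in>Basis. (p \<theta> x * (b \<bullet> s \<theta> x)) *\<^sub>R b)"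
    by (intro Bochner_Integration.integrable_sum integrable_scaleR_left
        dqm_integrable_directional[OF p nonneg dqm]) auto
  moreover have "(\<Sum>b\<in>Basis. (p \<theta> x * (b \<bullet> s \<theta> x)) *\<^sub>R b) = pdot p s \<theta> x" for x
    using euclidean_representation[of "s \<theta> x"]
    by (simp add: pdot_def inner_commute[of _ "s \<theta> x"] flip: scaleR_scaleR scaleR_right.sum)
  ultimately show ?thesis
    by simp
qed

section \<open>Existence of a consistent quantizer\<close>

text \<open>
  The bound on the error does not depend on \<open>\<theta>\<close>, which is stronger than the convergence along
  convergent sequences of parameters that consistency asks for.
\<close>

lemma quantizer_with_small_error:
  fixes \<Theta> :: "(real^'p) set" and \<mu> :: "(real^'d) measure"
    and p :: "real^'p \<Rightarrow> real^'d \<Rightarrow> real" and s :: "real^'p \<Rightarrow> real^'d \<Rightarrow> real^'p"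
    and i :: "real^'d \<Rightarrow> nat"
  assumes sf: "sigma_finite_measure \<mu>"
    and P: "\<And>\<theta>. \<theta> \<in> \<Theta> \<Longrightarrow> P \<theta> = density \<mu> (\<lambda>x. ennreal (p \<theta> x))"
    and p: "\<And>\<theta>. \<theta> \<in> \<Theta> \<Longrightarrow> integrable \<mu> (p \<theta>)"
    and pd: "\<And>\<theta>. \<theta> \<in> \<Theta> \<Longrightarrow> integrable \<mu> (pdot p s \<theta>)"
    and pm: "(\<lambda>(x, \<theta>). p \<theta> x) \<in> borel_measurable (\<mu> \<Otimes>\<^sub>M restrict_space borel \<Theta>)"
    and sm: "(\<lambda>(x, \<theta>). s \<theta> x) \<in> borel_measurable (\<mu> \<Otimes>\<^sub>M restrict_space borel \<Theta>)"
    and i: "i \<in> measurable \<mu> (count_space UNIV)"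
    and ifin: "(\<integral>\<^sup>+x. ennreal (1 / real (Suc (i x))) \<partial>\<mu>) < \<infinity>"
    and \<epsilon>: "0 < \<epsilon>"
  shows "\<exists>T k. T \<in> measurable (\<mu> \<Otimes>\<^sub>M restrict_space borel \<Theta>) (count_space {1..}) \<and>
    k \<in> measurable (restrict_space borel \<Theta>) (count_space {1..}) \<and>
    (\<forall>\<theta>\<in>\<Theta>. \<forall>x\<in>space \<mu>. T (x, \<theta>) \<in> {1..k \<theta>}) \<and>
    (\<forall>\<theta>\<in>\<Theta>. quantization_error \<mu> P p s (\<lambda>x. T (x, \<theta>)) (k \<theta>) \<theta> \<le>
      ennreal (4 * \<epsilon>) * (\<integral>\<^sup>+x. ennreal (1 / real (Suc (i x))) \<partial>\<mu>) + ennreal (4 * \<epsilon> + sqrt \<epsilon>))"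
proof -
  interpret sigma_finite_measure \<mu> by (rule sf)
  let ?N = "restrict_space borel \<Theta> :: (real^'p) measure"
  have spN: "space ?N = \<Theta>"
    by (simp add: space_restrict_space)
  define g where "g = (\<lambda>(x, \<theta>). (p \<theta> x, pdot p s \<theta> x))"
  have pm' [measurable]: "(\<lambda>z. p (snd z) (fst z)) \<in> borel_measurable (\<mu> \<Otimes>\<^sub>M ?N)"
    and sm' [measurable]: "(\<lambda>z. s (snd z) (fst z)) \<in> borel_measurable (\<mu> \<Otimes>\<^sub>M ?N)"
    using pm sm by (simp_all add: case_prod_beta')
  have g [measurable]: "g \<in> borel_measurable (\<mu> \<Otimes>\<^sub>M ?N)"
    unfolding g_def pdot_def case_prod_beta' by measurable
  note [measurable] = i
  obtain c :: "(real^'d) \<times> (real^'p) \<Rightarrow> nat" and \<iota> where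
    c [measurable]: "c \<in> measurable (\<mu> \<Otimes>\<^sub>M ?N) (count_space UNIV)"
    and \<iota>: "\<And>x t. \<iota> (c (x, t)) = i x"
    and close: "\<And>x y t. c (x, t) = c (y, t) \<Longrightarrow>
      dist (g (x, t)) (g (y, t)) \<le> 2 * (\<epsilon> * (1 / real (Suc (i x))))"
    using fine_countable_partition[OF g i, of "\<lambda>l. \<epsilon> * (1 / real (Suc l))"] \<epsilon> by auto
  define F where "F = (\<lambda>(x, \<theta>). ennreal (\<bar>p \<theta> x\<bar> + norm (pdot p s \<theta> x)))"
  have F: "F \<in> borel_measurable (\<mu> \<Otimes>\<^sub>M ?N)"
    unfolding F_def pdot_def case_prod_beta' by measurable
  have Ffin: "(\<integral>\<^sup>+x. F (x, \<theta>) \<partial>\<mu>) < \<infinity>" if "\<theta> \<in> space ?N" for \<theta>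
  proof -
    have "integrable \<mu> (\<lambda>x. \<bar>p \<theta> x\<bar> + norm (pdot p s \<theta> x))"
      using that p pd by (auto simp: spN)
    then show ?thesis
      by (simp add: F_def integrable_iff_bounded)
  qed
  obtain n where n [measurable]: "n \<in> measurable ?N (count_space UNIV)"
    and tail: "\<And>\<theta>. \<theta> \<in> \<Theta> \<Longrightarrow>
      (\<integral>\<^sup>+x. F (x, \<theta>) * indicator {x. n \<theta> \<le> c (x, \<theta>)} x \<partial>\<mu>) \<le> ennreal \<epsilon>"
    using measurable_truncation_index[OF F c Ffin, of "ennreal \<epsilon>"] \<epsilon> by (auto simp: spN)
  \<comment> \<open>Labels start at 0 and cells at 1; cell \<open>k \<theta>\<close> collects the labels from \<open>n \<theta>\<close> on.\<close>
  define T where "T z = Suc (min (c z) (n (snd z)))" for z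
  define k where "k \<theta> = Suc (n \<theta>)" for \<theta>
  have T: "T \<in> measurable (\<mu> \<Otimes>\<^sub>M ?N) (count_space UNIV)"
    unfolding T_def by measurable
  have k: "k \<in> measurable ?N (count_space UNIV)"
    unfolding k_def by measurable
  have err: "quantization_error \<mu> P p s (\<lambda>x. T (x, \<theta>)) (k \<theta>) \<theta> \<le>
      ennreal (4 * \<epsilon>) * (\<integral>\<^sup>+x. ennreal (1 / real (Suc (i x))) \<partial>\<mu>) + ennreal (4 * \<epsilon> + sqrt \<epsilon>)"
    if \<theta>: "\<theta> \<in> \<Theta>" for \<theta>
  proof -
    let ?t = "\<lambda>x. T (x, \<theta>)"
    let ?w = "\<lambda>x. 2 * (\<epsilon> * (1 / real (Suc (i x))))"
    have t: "?t \<in> measurable \<mu> (count_space UNIV)"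
      using T \<theta> spN by (intro measurable_compose[OF _ T] measurable_Pair2') auto
    have "quantization_error \<mu> P p s ?t (k \<theta>) \<theta>
        \<le> 2 * (\<integral>\<^sup>+x. ennreal (?w x) \<partial>\<mu>) + ennreal (4 * \<epsilon> + sqrt \<epsilon>)"
    proof (rule quantization_error_le[where w = ?w and \<delta> = \<epsilon>])
      show "T (x, \<theta>) \<in> {1..k \<theta>}" for x
        by (simp add: T_def k_def)
      show "?w \<in> borel_measurable \<mu>"
        by measurable
      show "emeasure \<mu> (cell \<mu> ?t j) < \<infinity>" if "j \<noteq> k \<theta>" for j
      proof -
        have "cell \<mu> ?t j \<subseteq> {x \<in> space \<mu>. i x = \<iota> (j - 1)}"
        proof
          fix x assume "x \<in> cell \<mu> ?t j"
          then have x: "x \<in> space \<mu>" "Suc (min (c (x, \<theta>)) (n \<theta>)) = j"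
            by (auto simp: cell_def T_def)
          then have "c (x, \<theta>) = j - 1"
            using that by (auto simp: k_def min_def split: if_splits)
          then show "x \<in> {x \<in> space \<mu>. i x = \<iota> (j - 1)}"
            using x(1) \<iota>[of x \<theta>] by simp
        qed
        then have "emeasure \<mu> (cell \<mu> ?t j) \<le> emeasure \<mu> {x \<in> space \<mu>. i x = \<iota> (j - 1)}"
          by (intro emeasure_mono) auto
        then show ?thesis
          using finite_measure_level_set[OF i ifin] by (rule le_less_trans)
      qed
      show "dist (p \<theta> x, pdot p s \<theta> x) (p \<theta> y, pdot p s \<theta> y) \<le> ?w x"
        if "T (x, \<theta>) = T (y, \<theta>)" "T (x, \<theta>) \<noteq> k \<theta>" for x y
      proof -
        have "c (x, \<theta>) = c (y, \<theta>)"
          using that by (auto simp: T_def k_def min_def split: if_splits)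
        from close[OF this] show ?thesis
          by (simp add: g_def)
      qed
      have "(\<integral>\<^sup>+x. ennreal (\<bar>p \<theta> x\<bar> + norm (pdot p s \<theta> x)) * indicator (cell \<mu> ?t (k \<theta>)) x \<partial>\<mu>)
          = (\<integral>\<^sup>+x. F (x, \<theta>) * indicator {x. n \<theta> \<le> c (x, \<theta>)} x \<partial>\<mu>)"
        by (intro nn_integral_cong)
          (auto simp: F_def cell_def T_def k_def indicator_def min_def split: if_splits)
      then show "(\<integral>\<^sup>+x. ennreal (\<bar>p \<theta> x\<bar> + norm (pdot p s \<theta> x)) * indicator (cell \<mu> ?t (k \<theta>)) x \<partial>\<mu>)
          \<le> ennreal \<epsilon>"
        using tail[OF \<theta>] by simp
    qed (use t P[OF \<theta>] p[OF \<theta>] pd[OF \<theta>] \<epsilon> in auto)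
    also have "2 * (\<integral>\<^sup>+x. ennreal (?w x) \<partial>\<mu>)
        = ennreal (4 * \<epsilon>) * (\<integral>\<^sup>+x. ennreal (1 / real (Suc (i x))) \<partial>\<mu>)"
    proof -
      have "(\<integral>\<^sup>+x. ennreal (?w x) \<partial>\<mu>)
          = (\<integral>\<^sup>+x. ennreal (2 * \<epsilon>) * ennreal (1 / real (Suc (i x))) \<partial>\<mu>)"
        using \<epsilon> by (intro nn_integral_cong) (simp flip: ennreal_mult)
      also have "\<dots> = ennreal (2 * \<epsilon>) * (\<integral>\<^sup>+x. ennreal (1 / real (Suc (i x))) \<partial>\<mu>)"
        by (rule nn_integral_cmult) measurable
      also have "2 * \<dots> = ennreal (4 * \<epsilon>) * (\<integral>\<^sup>+x. ennreal (1 / real (Suc (i x))) \<partial>\<mu>)"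
        using \<epsilon> by (simp add: ennreal_mult flip: mult.assoc)
      finally show ?thesis .
    qed
    finally show ?thesis .
  qed
  have "T \<in> measurable (\<mu> \<Otimes>\<^sub>M ?N) (count_space {1..})"
    by (rule measurable_count_space_extend[OF _ _ T]) (auto simp: T_def)
  moreover have "k \<in> measurable ?N (count_space {1..})"
    by (rule measurable_count_space_extend[OF _ _ k]) (auto simp: k_def)
  moreover have "\<forall>\<theta>\<in>\<Theta>. \<forall>x\<in>space \<mu>. T (x, \<theta>) \<in> {1..k \<theta>}"
    by (simp add: T_def k_def)
  ultimately show ?thesis
    using err by blast
qed

theorem lemma4p4:
  fixes \<Theta> :: "(real^'p) set"
    and X :: "(real^'d) set"
    and \<mu> :: "(real^'d) measure"
    and P :: "real^'p \<Rightarrow> (real^'d) measure"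
    and p :: "real^'p \<Rightarrow> real^'d \<Rightarrow> real"
    and s :: "real^'p \<Rightarrow> real^'d \<Rightarrow> real^'p"
  assumes sets_mu: "sets \<mu> = sets (restrict_space borel X)"
    and sigma_finite: "sigma_finite_measure \<mu>"
    and finite_on_compact: "\<And>C. compact C \<Longrightarrow> C \<subseteq> X \<Longrightarrow> emeasure \<mu> C < \<infinity>"
    and prob: "\<And>\<theta>. \<theta> \<in> \<Theta> \<Longrightarrow> prob_space (P \<theta>)"
    and p_nonneg: "\<And>\<theta> x. \<theta> \<in> \<Theta> \<Longrightarrow> x \<in> X \<Longrightarrow> 0 \<le> p \<theta> x"
    and density: "\<And>\<theta>. \<theta> \<in> \<Theta> \<Longrightarrow> P \<theta> = density \<mu> (\<lambda>x. ennreal (p \<theta> x))"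
    and dqm: "\<And>\<theta>. \<theta> \<in> \<Theta> \<Longrightarrow> dqm_at \<mu> \<Theta> p \<theta> (s \<theta>)"
    and p_measurable:
      "(\<lambda>(x, \<theta>). p \<theta> x) \<in> borel_measurable (restrict_space borel X \<Otimes>\<^sub>M restrict_space borel \<Theta>)"
    and s_measurable:
      "(\<lambda>(x, \<theta>). s \<theta> x) \<in> borel_measurable (restrict_space borel X \<Otimes>\<^sub>M restrict_space borel \<Theta>)"
  shows "\<exists>T. consistent_quantizer \<mu> \<Theta> P p s T"
proof -
  let ?N = "restrict_space borel \<Theta> :: (real^'p) measure"
  have space_mu: "space \<mu> = X"
    using sets_eq_imp_space_eq[OF sets_mu] by (simp add: space_restrict_space)
  have "sets (\<mu> \<Otimes>\<^sub>M ?N) = sets (restrict_space borel X \<Otimes>\<^sub>M ?N)"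
    by (rule sets_pair_measure_cong[OF sets_mu refl])
  note pair_cong = measurable_cong_sets[OF this refl]
  have pm: "(\<lambda>(x, \<theta>). p \<theta> x) \<in> borel_measurable (\<mu> \<Otimes>\<^sub>M ?N)"
    using p_measurable by (simp only: pair_cong)
  have sm: "(\<lambda>(x, \<theta>). s \<theta> x) \<in> borel_measurable (\<mu> \<Otimes>\<^sub>M ?N)"
    using s_measurable by (simp only: pair_cong)
  have p_int: "integrable \<mu> (p \<theta>)" if \<theta>: "\<theta> \<in> \<Theta>" for \<theta>
  proof (rule integrableI_nonneg)
    show p\<theta>: "p \<theta> \<in> borel_measurable \<mu>"
      using measurable_compose[OF measurable_Pair2'[of \<theta> ?N \<mu>] pm] \<theta>
      by (simp add: space_restrict_space)
    show "AE x in \<mu>. 0 \<le> p \<theta> x"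
      using p_nonneg[OF \<theta>] by (intro AE_I2) (simp add: space_mu)
    have "(\<integral>\<^sup>+x. ennreal (p \<theta> x) \<partial>\<mu>) = emeasure (P \<theta>) (space \<mu>)"
      using p\<theta> by (simp add: density[OF \<theta>] emeasure_density)
    also have "\<dots> = 1"
      using prob_space.emeasure_space_1[OF prob[OF \<theta>]] by (simp add: density[OF \<theta>])
    finally show "(\<integral>\<^sup>+x. ennreal (p \<theta> x) \<partial>\<mu>) < \<infinity>"
      by simp
  qed
  have pd_int: "integrable \<mu> (pdot p s \<theta>)" if "\<theta> \<in> \<Theta>" for \<theta>
    by (rule dqm_integrable_pdot[where \<Theta> = \<Theta>]) (use p_int p_nonneg space_mu dqm that in auto)
  obtain i :: "real^'d \<Rightarrow> nat" where i: "i \<in> measurable \<mu> (count_space UNIV)"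
    and ifin: "(\<integral>\<^sup>+x. ennreal (1 / real (Suc (i x))) \<partial>\<mu>) < \<infinity>"
    using sigma_finite_measure.integrable_reciprocal_index[OF sigma_finite] by blast
  obtain C where C: "(\<integral>\<^sup>+x. ennreal (1 / real (Suc (i x))) \<partial>\<mu>) = ennreal C" "0 \<le> C"
    using ifin by (cases "\<integral>\<^sup>+x. ennreal (1 / real (Suc (i x))) \<partial>\<mu>") auto
  define \<epsilon> where "\<epsilon> m = inverse (real (Suc m))" for m
  have \<epsilon>: "0 < \<epsilon> m" for m
    by (simp add: \<epsilon>_def)
  have "\<forall>m. \<exists>T k. T \<in> measurable (\<mu> \<Otimes>\<^sub>M ?N) (count_space {1..}) \<and>
      k \<in> measurable ?N (count_space {1..}) \<and>
      (\<forall>\<theta>\<in>\<Theta>. \<forall>x\<in>space \<mu>. T (x, \<theta>) \<in> {1..k \<theta>}) \<and>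
      (\<forall>\<theta>\<in>\<Theta>. quantization_error \<mu> P p s (\<lambda>x. T (x, \<theta>)) (k \<theta>) \<theta> \<le>
        ennreal (4 * \<epsilon> m) * ennreal C + ennreal (4 * \<epsilon> m + sqrt (\<epsilon> m)))"
    using quantizer_with_small_error[OF sigma_finite density p_int pd_int pm sm i ifin \<epsilon>]
    unfolding C by blast
  then obtain T k where T: "\<And>m. T m \<in> measurable (\<mu> \<Otimes>\<^sub>M ?N) (count_space {1..})"
    and k: "\<And>m. k m \<in> measurable ?N (count_space {1..})"
    and range: "\<And>m \<theta> x. \<theta> \<in> \<Theta> \<Longrightarrow> x \<in> space \<mu> \<Longrightarrow> T m (x, \<theta>) \<in> {1..k m \<theta>}"
    and err: "\<And>m \<theta>. \<theta> \<in> \<Theta> \<Longrightarrow> quantization_error \<mu> P p s (\<lambda>x. T m (x, \<theta>)) (k m \<theta>) \<theta>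
      \<le> ennreal (4 * \<epsilon> m) * ennreal C + ennreal (4 * \<epsilon> m + sqrt (\<epsilon> m))"
    by metis
  have "(\<lambda>m. 4 * \<epsilon> m * C + (4 * \<epsilon> m + sqrt (\<epsilon> m))) \<longlonglongrightarrow> 4 * 0 * C + (4 * 0 + sqrt 0)"
    unfolding \<epsilon>_def by (intro tendsto_intros LIMSEQ_inverse_real_of_nat)
  then have "(\<lambda>m. ennreal (4 * \<epsilon> m * C + (4 * \<epsilon> m + sqrt (\<epsilon> m)))) \<longlonglongrightarrow> 0"
    using tendsto_ennrealI by fastforce
  moreover have "ennreal (4 * \<epsilon> m) * ennreal C + ennreal (4 * \<epsilon> m + sqrt (\<epsilon> m))
      = ennreal (4 * \<epsilon> m * C + (4 * \<epsilon> m + sqrt (\<epsilon> m)))" for m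
    using \<epsilon>[of m] C(2) by (simp add: ennreal_mult ennreal_plus)
  ultimately have bound: "(\<lambda>m. ennreal (4 * \<epsilon> m) * ennreal C + ennreal (4 * \<epsilon> m + sqrt (\<epsilon> m)))
      \<longlonglongrightarrow> 0"
    by simp
  have "(\<lambda>m. quantization_error \<mu> P p s (\<lambda>x. T m (x, \<theta>s m)) (k m (\<theta>s m)) (\<theta>s m)) \<longlonglongrightarrow> 0"
    if \<theta>s: "\<forall>m\<ge>1. \<theta>s m \<in> \<Theta>" for \<theta>s :: "nat \<Rightarrow> real^'p"
  proof (rule tendsto_sandwich[OF _ _ tendsto_const bound])
    show "\<forall>\<^sub>F m in sequentially. quantization_error \<mu> P p s (\<lambda>x. T m (x, \<theta>s m)) (k m (\<theta>s m)) (\<theta>s m)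
        \<le> ennreal (4 * \<epsilon> m) * ennreal C + ennreal (4 * \<epsilon> m + sqrt (\<epsilon> m))"
      using eventually_ge_at_top[of 1] by eventually_elim (use err \<theta>s in blast)
  qed auto
  then show ?thesis
    unfolding consistent_quantizer_def using T k range by blast
qed

end
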